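(* Let $\mathcal{A}$ be a Rickart *-ring and $a,b\in\mathcal{A}$. Put $b_r=\mathrm{rp}(b)\,b$. Then: (a) $a\preceq^{*|\ell\square} b$ if and only if there exists $p\in E(\mathcal{A})$ such that $a=bp$, $p\le\mathrm{rp}(b)$, $pb^*b=b^*bp$ and $pb_rp=pb_r$; (b) $a\preceq^{*|r\square} b$ if and only if there exists $p\in E(\mathcal{A})$ such that $a=bp$, $p\le\mathrm{rp}(b)$, $pb^*b=b^*bp$ and $pb_rp=b_rp$; (c) $a\preceq^{*|\square} b$ if and only if there exists $p\in E(\mathcal{A})$ such that $a=bp$, $p\le\mathrm{rp}(b)$, $pb^*b=b^*bp$ and $pb_r=b_rp$. Moreover, in each case, the element $p$ is unique.
   Context: A *-ring is an (associative) ring $\mathcal{A}$ with an involution $*$: $(a+b)^*=a^*+b^*$, $(ab)^*=b^*a^*$, $(a^* )^*=a$. It is a Rickart *-ring if for every $a\in\mathcal{A}$ there is a self-adjoint idempotent $p$ (i.e. $p=p^*=p^2$) with $\{x\in\mathcal{A}: xa=0\}=\mathcal{A}(1-p)$; such a ring has an identity $1$, and $p$ is unique and denoted $\mathrm{lp}(a)$. Likewise, for every $a$ there is a unique self-adjoint idempotent $\mathrm{rp}(a)$ with $\{x\in\mathcal{A}: ax=0\}=(1-\mathrm{rp}(a))\mathcal{A}$. $E(\mathcal{A})$ is the set of self-adjoint idempotents, partially ordered by $p\le q$ iff $p=pq$. Partial orders on $\mathcal{A}$: $a\preceq^{*|\ell\square} b$ iff $\mathrm{lp}(a)b=a=b\,\mathrm{rp}(a)$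 and $a^2=ab$; $a\preceq^{*|r\square} b$ iff $\mathrm{lp}(a)b=a=b\,\mathrm{rp}(a)$ and $a^2=ba$; $a\preceq^{*|\square} b$ iff $\mathrm{lp}(a)b=a=b\,\mathrm{rp}(a)$ and $a^2=ab=ba$. *)

theory Defs
  imports Main
begin

class star_ring = ring +
  fixes star :: "'a \<Rightarrow> 'a"
  assumes star_add: "star (x + y) = star x + star y"
    and star_mult: "star (x * y) = star y * star x"
    and star_star: "star (star x) = x"

definition self_adjoint_idempotents :: "'a::star_ring set" where
  "self_adjoint_idempotents = {p. p = star p \<and> p = p * p}"

text \<open>
  The order is only meant to be used between self-adjoint idempotents.
\<close>

definition proj_le :: "'a::star_ring \<Rightarrow> 'a \<Rightarrow> bool" where
  "proj_le p q \<longleftrightarrow> p = p * q"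

text \<open>
  A ring in which every left annihilator of an element is generated, as a left ideal, by a
  self-adjoint idempotent automatically has an identity. Hence nothing is lost by including the
  identity in the class of Rickart *-rings below, where it is needed to write \<open>1 - p\<close>.
\<close>

lemma identity_if_annihilators_generated:
  assumes "\<And>a::'a::star_ring. \<exists>e \<in> self_adjoint_idempotents. {x. x * a = 0} = range (\<lambda>x. x * e)"
  shows "\<exists>u::'a. \<forall>x. u * x = x \<and> x * u = x"
proof -
  obtain e :: 'a where e: "e = star e" "e = e * e" and "{x. x * 0 = 0} = range (\<lambda>x. x * e)"
    using assms[of 0] unfolding self_adjoint_idempotents_def by blast
  then have "\<exists>y. x = y * e" for x
    by auto
  then have r: "x * e = x" for x
    by (metis e(2) mult.assoc)
  have "e * x = x" for x
    by (metis r e(1) star_mult star_star)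
  with r show ?thesis by blast
qed

text \<open>
  The class extends both \<open>ring\<close> and \<open>monoid_mult\<close> rather than \<open>ring_1\<close>, since the latter
  excludes the zero ring.
\<close>

class rickart_star_ring = star_ring + monoid_mult +
  assumes rickart:
    "\<exists>p. p = star p \<and> p = p * p \<and> {x. x * a = 0} = range (\<lambda>x. x * (1 - p))"

definition lp :: "'a::rickart_star_ring \<Rightarrow> 'a" where
  "lp a = (THE p. p \<in> self_adjoint_idempotents \<and> {x. x * a = 0} = range (\<lambda>x. x * (1 - p)))"

definition rp :: "'a::rickart_star_ring \<Rightarrow> 'a" where
  "rp a = (THE p. p \<in> self_adjoint_idempotents \<and> {x. a * x = 0} = range (\<lambda>x. (1 - p) * x))"

definition star_lsquare_le :: "'a::rickart_star_ring \<Rightarrow> 'a \<Rightarrow> bool" where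
  "star_lsquare_le a b \<longleftrightarrow> lp a * b = a \<and> a = b * rp a \<and> a\<^sup>2 = a * b"

definition star_rsquare_le :: "'a::rickart_star_ring \<Rightarrow> 'a \<Rightarrow> bool" where
  "star_rsquare_le a b \<longleftrightarrow> lp a * b = a \<and> a = b * rp a \<and> a\<^sup>2 = b * a"

definition star_square_le :: "'a::rickart_star_ring \<Rightarrow> 'a \<Rightarrow> bool" where
  "star_square_le a b \<longleftrightarrow> lp a * b = a \<and> a = b * rp a \<and> a\<^sup>2 = a * b \<and> a * b = b * a"

lemma star_0: "star (0::'a::star_ring) = 0"
  by (metis add_cancel_right_right star_add)

lemma star_diff: "star (x - y) = star x - star (y::'a::star_ring)"
  by (metis add_diff_cancel diff_add_cancel star_add)

lemma star_1: "star (1::'a::rickart_star_ring) = 1"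
  by (metis mult_1_left mult_1_right star_mult star_star)

lemma left_annihilator_unique:
  fixes p q :: "'a::rickart_star_ring"
  assumes p: "p \<in> self_adjoint_idempotents" and q: "q \<in> self_adjoint_idempotents"
    and eq: "range (\<lambda>x. x * (1 - p)) = range (\<lambda>x. x * (1 - q))"
  shows "p = q"
proof -
  have *: "s = r * s"
    if s: "s \<in> self_adjoint_idempotents" and rs: "range (\<lambda>x. x * (1 - r)) = range (\<lambda>x. x * (1 - s))"
    for r s :: 'a
  proof -
    have "1 - r \<in> range (\<lambda>x. x * (1 - s))"
      unfolding rs[symmetric] by (rule range_eqI[of _ _ 1]) simp
    then obtain y where y: "1 - r = y * (1 - s)" by blast
    have "(1 - s) * s = 0"
      using s by (simp add: self_adjoint_idempotents_def left_diff_distrib)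
    then have "(1 - r) * s = 0" by (simp add: y mult.assoc)
    then show ?thesis by (simp add: left_diff_distrib)
  qed
  have "q = p * q" "p = q * p"
    using *[OF q eq] *[OF p eq[symmetric]] by auto
  then show ?thesis
    using p q star_mult[of p q] by (simp add: self_adjoint_idempotents_def)
qed

lemma right_annihilator_iff:
  fixes a p :: "'a::rickart_star_ring"
  assumes p: "p \<in> self_adjoint_idempotents"
  shows "{x. a * x = 0} = range (\<lambda>x. (1 - p) * x) \<longleftrightarrow>
    {x. x * star a = 0} = range (\<lambda>x. x * (1 - p))"
proof -
  have sp: "star (1 - p) = 1 - p"
    using p by (simp add: self_adjoint_idempotents_def star_diff star_1)
  have 1: "x * star a = 0 \<longleftrightarrow> a * star x = 0" for x
    by (metis star_0 star_mult star_star)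
  have 2: "x \<in> range (\<lambda>x. x * (1 - p)) \<longleftrightarrow> star x \<in> range (\<lambda>x. (1 - p) * x)" for x
    unfolding image_iff by (metis UNIV_I sp star_mult star_star)
  show ?thesis
    unfolding set_eq_iff mem_Collect_eq 1 2 by (metis star_star)
qed

lemma lp_spec:
  fixes a :: "'a::rickart_star_ring"
  shows "lp a \<in> self_adjoint_idempotents \<and> {x. x * a = 0} = range (\<lambda>x. x * (1 - lp a))"
proof -
  have "\<exists>!p. p \<in> self_adjoint_idempotents \<and> {x. x * a = 0} = range (\<lambda>x. x * (1 - p))"
  proof -
    obtain p where p: "p \<in> self_adjoint_idempotents" "{x. x * a = 0} = range (\<lambda>x. x * (1 - p))"
      using rickart[of a] unfolding self_adjoint_idempotents_def by blast
    then show ?thesis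
      by (intro ex1I[of _ p] conjI) (auto intro: left_annihilator_unique)
  qed
  from theI'[OF this] show ?thesis by (simp add: lp_def)
qed

lemma rp_eq_lp_star: "rp (a::'a::rickart_star_ring) = lp (star a)"
  unfolding rp_def lp_def by (simp add: right_annihilator_iff cong: conj_cong)

lemma rp_spec:
  fixes a :: "'a::rickart_star_ring"
  shows "rp a \<in> self_adjoint_idempotents \<and> {x. a * x = 0} = range (\<lambda>x. (1 - rp a) * x)"
  using lp_spec[of "star a"] right_annihilator_iff[of "rp a" a] by (simp add: rp_eq_lp_star)

end

(*
  If a = b p with p <= rp b, then a x = 0 iff rp b p x = p x = 0, so p can only be rp a; this gives
  uniqueness and reduces each existence claim to a claim about rp a. Commutation of p with b* b
  encodes that b p = lp a b. Finally, left multiplication by b can be cancelled up to rp b, which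
  turns a^2 = a b and a^2 = b a into the conditions on br = rp b b.
*)

theory Submission
  imports Defs
begin

lemma lp_self_adjoint: "star (lp a) = lp a"
  using lp_spec[of a] by (auto simp: self_adjoint_idempotents_def)

lemma rp_self_adjoint: "star (rp a) = rp a"
  and rp_idem: "rp a * rp a = rp a"
  using rp_spec[of a] by (auto simp: self_adjoint_idempotents_def)

text \<open>The ideal \<open>(1 - rp a) * x\<close> is the right annihilator of \<open>a\<close>,
  and also that of the idempotent \<open>rp a\<close>.\<close>

lemma mult_right_eq_0_iff_rp:
  fixes a :: "'a::rickart_star_ring"
  shows "a * x = 0 \<longleftrightarrow> rp a * x = 0"
proof
  assume "a * x = 0"
  then obtain y where "x = (1 - rp a) * y"
    using rp_spec[of a] by blast
  moreover have "rp a * (1 - rp a) = 0"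
    by (simp add: right_diff_distrib rp_idem)
  ultimately show "rp a * x = 0"
    by (simp add: mult.assoc[symmetric])
next
  assume "rp a * x = 0"
  then have "x = (1 - rp a) * x"
    by (simp add: left_diff_distrib)
  then show "a * x = 0"
    using rp_spec[of a] by blast
qed

lemma mult_left_cancel_iff_rp:
  fixes a :: "'a::rickart_star_ring"
  shows "a * x = a * y \<longleftrightarrow> rp a * x = rp a * y"
  using mult_right_eq_0_iff_rp[of a "x - y"] by (simp add: right_diff_distrib)

lemma mult_rp: "a * rp a = a"
  using mult_left_cancel_iff_rp[of a "rp a" 1] by (simp add: rp_idem)

text \<open>Adjoints exchange the two projections: \<open>lp a\<close> is the right projection of
  \<open>star a\<close>.\<close>

lemma star_mult_eq_0_iff_lp:
  fixes a :: "'a::rickart_star_ring"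
  shows "star a * x = 0 \<longleftrightarrow> lp a * x = 0"
  using mult_right_eq_0_iff_rp[of "star a" x] by (simp add: rp_eq_lp_star star_star)

lemma lp_mult: "lp a * a = a"
  by (metis lp_self_adjoint mult_rp rp_eq_lp_star star_mult star_star)

lemma proj_le_rp_commute:
  assumes "p \<in> self_adjoint_idempotents" "proj_le p (rp b)"
  shows "rp b * p = p" "p * rp b = p"
proof -
  show "p * rp b = p"
    using assms by (simp add: proj_le_def)
  then show "rp b * p = p"
    using assms star_mult[of p "rp b"] by (simp add: self_adjoint_idempotents_def rp_self_adjoint)
qed

lemma rp_eqI:
  fixes a b p :: "'a::rickart_star_ring"
  assumes p: "p \<in> self_adjoint_idempotents" and a: "a = b * p" and le: "proj_le p (rp b)"
  shows "rp a = p"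
proof -
  have ann: "a * x = 0 \<longleftrightarrow> p * x = 0" for x
    using mult_right_eq_0_iff_rp[of b "p * x"] proj_le_rp_commute[OF p le]
    by (simp add: a mult.assoc[symmetric])
  \<comment> \<open>\<open>a\<close> and \<open>p\<close> have the same right annihilator; it
    contains \<open>rp a - 1\<close> and \<open>p - 1\<close>, so each projection absorbs the
    other.\<close>
  have "p * rp a = p"
    using ann[of "rp a - 1"] by (simp add: right_diff_distrib mult_rp)
  moreover have "rp a * p = rp a"
    using ann[of "p - 1"] mult_right_eq_0_iff_rp[of a "p - 1"] p
    by (simp add: right_diff_distrib self_adjoint_idempotents_def)
  ultimately show ?thesis
    using star_mult[of p "rp a"] p by (simp add: self_adjoint_idempotents_def rp_self_adjoint)
qed

text \<open>
  The left-hand side is the *-order, the part common to all three orders.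
\<close>

lemma star_order_iff_rp:
  fixes a b :: "'a::rickart_star_ring"
  shows "lp a * b = a \<and> a = b * rp a \<longleftrightarrow>
    a = b * rp a \<and> proj_le (rp a) (rp b) \<and> rp a * star b * b = star b * b * rp a"
    (is "?L \<longleftrightarrow> ?R")
proof
  assume ?L
  then have l: "lp a * b = a" and r: "b * rp a = a" by auto
  \<comment> \<open>As \<open>lp a * b\<close>, the element \<open>a\<close> is a left multiple of
    \<open>b\<close> and so absorbs \<open>rp b\<close>.\<close>
  have "a * rp b = a"
    by (metis l mult.assoc mult_rp)
  then have "rp a * rp b = rp a"
    using mult_left_cancel_iff_rp[of a "rp b" 1] by simp
  \<comment> \<open>Both sides equal \<open>star b * lp a * b\<close>.\<close>
  moreover have "rp a * star b * b = star b * b * rp a"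
  proof -
    have "rp a * star b = star a" "star b * lp a = star a"
      using star_mult[of b "rp a"] star_mult[of "lp a" b]
      by (simp_all add: r l rp_self_adjoint lp_self_adjoint)
    then show ?thesis
      by (metis l mult.assoc r)
  qed
  ultimately show ?R
    by (simp add: proj_le_def r)
next
  assume ?R
  then have r: "b * rp a = a" and c: "rp a * star b * b = star b * b * rp a" by auto
  \<comment> \<open>Once \<open>star a\<close> kills \<open>b - a\<close>, so does
    \<open>lp a\<close>, whence \<open>lp a * b = lp a * a = a\<close>. Commutation brings the two
    copies of \<open>rp a\<close> in \<open>star a * a\<close> together, where they merge.\<close>
  have "star a * b = star a * a"
  proof -
    have sa: "star a = rp a * star b"
      using star_mult[of b "rp a"] by (simp add: r rp_self_adjoint)
    have "star a * a = rp a * star b * b * rp a"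
      by (simp add: sa mult.assoc r)
    also have "\<dots> = star b * b * (rp a * rp a)"
      unfolding c by (simp only: mult.assoc)
    also have "\<dots> = star a * b"
      by (simp add: sa c rp_idem)
    finally show ?thesis ..
  qed
  then have "lp a * (b - a) = 0"
    using star_mult_eq_0_iff_lp[of a "b - a"] by (simp add: right_diff_distrib)
  then show ?L
    by (simp add: right_diff_distrib lp_mult r)
qed

text \<open>Each product starts with \<open>b\<close>: the three are \<open>b * (p * b * p)\<close>,
  \<open>b * (p * b)\<close> and \<open>b * (b * p)\<close>. Cancelling \<open>b\<close> leaves a
  factor \<open>rp b\<close>, which \<open>p\<close> absorbs on either side.\<close>

lemma square_eq_mult_iff:
  fixes a b p :: "'a::rickart_star_ring"
  assumes p: "p \<in> self_adjoint_idempotents" and a: "a = b * p" and le: "proj_le p (rp b)"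
  shows "a\<^sup>2 = a * b \<longleftrightarrow> p * (rp b * b) * p = p * (rp b * b)"
    and "a\<^sup>2 = b * a \<longleftrightarrow> p * (rp b * b) * p = rp b * b * p"
  using mult_left_cancel_iff_rp[of b "p * b * p" "p * b"]
    mult_left_cancel_iff_rp[of b "p * b * p" "b * p"] proj_le_rp_commute[OF p le]
  by (simp_all add: a power2_eq_square mult.assoc[symmetric])

lemma square_eq_both_iff:
  fixes a b p :: "'a::rickart_star_ring"
  assumes p: "p \<in> self_adjoint_idempotents" and a: "a = b * p" and le: "proj_le p (rp b)"
  shows "a\<^sup>2 = a * b \<and> a * b = b * a \<longleftrightarrow> p * (rp b * b) = rp b * b * p"
proof -
  let ?c = "rp b * b"
  have "a\<^sup>2 = a * b \<and> a * b = b * a \<longleftrightarrow> a\<^sup>2 = a * b \<and> a\<^sup>2 = b * a"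
    by auto
  also have "\<dots> \<longleftrightarrow> p * ?c * p = p * ?c \<and> p * ?c * p = ?c * p"
    by (simp only: square_eq_mult_iff[OF assms])
  \<comment> \<open>For the converse, multiply the commutation relation by \<open>p\<close> on the
    left and on the right.\<close>
  also have "\<dots> \<longleftrightarrow> p * ?c = ?c * p"
    using p by (auto simp: self_adjoint_idempotents_def) (metis mult.assoc)+
  finally show ?thesis .
qed

text \<open>By \<open>rp_eqI\<close> the only candidate for the witness is \<open>rp a\<close>. The
  predicate \<open>Q\<close> stands for the condition on \<open>rp b * b\<close> that distinguishes
  the three orders.\<close>

lemma ex_projection_iff_rp:
  fixes a b :: "'a::rickart_star_ring"
  shows "(\<exists>p \<in> self_adjoint_idempotents. a = b * p \<and> proj_le p (rp b) \<and>
      p * star b * b = star b * b * p \<and> Q p) \<longleftrightarrow>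
    lp a * b = a \<and> a = b * rp a \<and> Q (rp a)"
proof -
  have "(\<exists>p \<in> self_adjoint_idempotents. a = b * p \<and> proj_le p (rp b) \<and>
      p * star b * b = star b * b * p \<and> Q p) \<longleftrightarrow>
    a = b * rp a \<and> proj_le (rp a) (rp b) \<and> rp a * star b * b = star b * b * rp a \<and> Q (rp a)"
    (is "?E \<longleftrightarrow> ?R")
  proof
    assume ?E
    then show ?R
      using rp_eqI[of _ a b] by metis
  next
    assume ?R
    then show ?E
      using rp_spec[of a] by (intro bexI[of _ "rp a"]) simp_all
  qed
  then show ?thesis
    using star_order_iff_rp[of a b] by blast
qed

theorem corollary33:
  fixes a b br :: "'a::rickart_star_ring"
  assumes br: "br = rp b * b"
  shows "(star_lsquare_le a b \<longleftrightarrow>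
      (\<exists>p \<in> self_adjoint_idempotents. a = b * p \<and> proj_le p (rp b) \<and>
        p * star b * b = star b * b * p \<and> p * br * p = p * br)) \<and>
    (\<exists>\<^sub>\<le>\<^sub>1 p. p \<in> self_adjoint_idempotents \<and> a = b * p \<and> proj_le p (rp b) \<and>
        p * star b * b = star b * b * p \<and> p * br * p = p * br) \<and>
    (star_rsquare_le a b \<longleftrightarrow>
      (\<exists>p \<in> self_adjoint_idempotents. a = b * p \<and> proj_le p (rp b) \<and>
        p * star b * b = star b * b * p \<and> p * br * p = br * p)) \<and>
    (\<exists>\<^sub>\<le>\<^sub>1 p. p \<in> self_adjoint_idempotents \<and> a = b * p \<and> proj_le p (rp b) \<and>
        p * star b * b = star b * b * p \<and> p * br * p = br * p) \<and>
    (star_square_le a b \<longleftrightarrow>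
      (\<exists>p \<in> self_adjoint_idempotents. a = b * p \<and> proj_le p (rp b) \<and>
        p * star b * b = star b * b * p \<and> p * br = br * p)) \<and>
    (\<exists>\<^sub>\<le>\<^sub>1 p. p \<in> self_adjoint_idempotents \<and> a = b * p \<and> proj_le p (rp b) \<and>
        p * star b * b = star b * b * p \<and> p * br = br * p)"
proof -
  have star_order: "proj_le (rp a) (rp b)" if "lp a * b = a" "a = b * rp a"
    using that star_order_iff_rp[of a b] by blast
  have rp: "rp a \<in> self_adjoint_idempotents"
    using rp_spec[of a] by blast
  \<comment> \<open>The *-order supplies \<open>proj_le (rp a) (rp b)\<close>, so the conditions on
    squares can be translated at \<open>p = rp a\<close>.\<close>
  note square_iff = square_eq_mult_iff[OF rp _ star_order] square_eq_both_iff[OF rp _ star_order]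
  \<comment> \<open>Any such \<open>p\<close> equals \<open>rp a\<close>, whatever \<open>Q\<close>
    is.\<close>
  have unique: "\<exists>\<^sub>\<le>\<^sub>1 p. p \<in> self_adjoint_idempotents \<and> a = b * p \<and> proj_le p (rp b) \<and>
      p * star b * b = star b * b * p \<and> Q p" for Q
    by (rule Uniq_I) (metis rp_eqI)
  show ?thesis
    unfolding ex_projection_iff_rp star_lsquare_le_def star_rsquare_le_def star_square_le_def br
    by (intro conjI unique) (use square_iff in blast)+
qed

end
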